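(* Let $\mathcal{I}$ be an instance of stochastic set cover (possibly with imperfect coverage, i.e. without assuming that every element of the ground set lies in some item's state), with items $\mathcal{A}$, ground set $\mathcal{B}$, costs $C(F)\ge0$, state distributions $p_F$ and marginals $q_F$, as defined in the context. Let $\mathcal{E}=\{(F,e)\in\mathcal{A}\times\mathcal{B}: q_F(e)>0\}$ (the edge set of the bipartite graph induced by $\mathcal{I}$). Let $\mathcal{J}$ be the instance with item set $\mathcal{A}$, the same costs, ground set $\mathcal{E}$, in which the state of item $F$ is $\mu_F(V(F))$, where $V(F)$ is the state of $F$ in $\mathcal{I}$ and $\mu_F(B)=\{(F_1,e)\in\mathcal{E}: F_1=F \text{ or } e\in B\}$; thus the marginals of $\mathcal{J}$ are $m_F((F_1,e))=1$ if $F_1=F$ and $m_F((F_1,e))=q_F(e)$ if $F_1\neq F$. Then the set of items evaluated by \texttt{Greedy} run on $\mathcal{J}$ (using the marginals $m_F$) is a feasible solution for $\mathcal{I}$, and its expected cost is at most $H(|\mathcal{E}|)$ times the expected cost of an optimal (feasible, adaptive, oblivious) algorithm for $\mathcal{I}$, where $H(n)=\sum_{k=1}^n1/k$.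
   Context: Stochastic set cover: we are given a finite ground set $\mathcal{B}$ and a finite set of items $\mathcal{A}$. Each item $F\in\mathcal{A}$ has a cost $C(F)\ge 0$ and a probability distribution $p_F$ on $2^{\mathcal{B}}$; the state of $F$ is a random subset $V(F)\sim p_F$, and the states of distinct items are mutually independent. Let $q_F(e)=\Pr[e\in V(F)]$. Evaluating an item reveals its state (repeated evaluations yield the same state). An (adaptive) algorithm evaluates items one at a time, where the choice of the next item (or the decision to stop) may depend on the states of previously evaluated items; it is oblivious, i.e. conditioning on the event that an item was evaluated does not change that item's state distribution. An algorithm is feasible if the set $\mathcal{S}$ of items it evaluates satisfies $\Pr\left[\bigcup_{F\in\mathcal{S}}V(F)=\bigcup_{F\in\mathcal{A}}V(F)\right]=1$; its cost is $\mathbf{E}[\sum_{F\in\mathcal{S}}C(F)]$, and an optimal algorithm is a feasible one of minimum cost. Algorithm \texttt{Greedy} on an instance with items $\mathcal{A}$, ground set $\mathcal{U}$ and marginals $r_F(u)=\Pr[u\in\text{state of }F]$: set $\mathcal{A}_1=\mathcal{A}$, $\mathcal{U}_1=\mathcal{U}$. At step $i$, if $\mathcal{U}_i=\emptyset$ stop; otherwise evaluate an item $F_i\in\mathcal{A}_i$ with $\sum_{u\in\mathcal{U}_i}r_F(u)>0$ minimizing $C(F)/\sum_{u\in\mathcal{U}_i}r_F(u)$ (ties broken arbitrarily), and set $\mathcal{A}_{i+1}=\mathcal{A}_i\setminus\{F_i\}$, $\mathcal{U}_{i+1}=\mathcal{U}_i\setminus(\text{state of }F_i)$. *)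

theory Defs
  imports "HOL-Probability.Probability"
begin

section \<open>Instances of stochastic set cover\<close>

record ('a, 'b) ssc =
  items :: "'a set"
  ground :: "'b set"
  cost :: "'a \<Rightarrow> real"
  state_pmf :: "'a \<Rightarrow> 'b set pmf"

definition ssc_instance :: "('a, 'b) ssc \<Rightarrow> bool" where
  "ssc_instance I \<longleftrightarrow> finite (items I) \<and> finite (ground I) \<and>
     (\<forall>F\<in>items I. 0 \<le> cost I F \<and> set_pmf (state_pmf I F) \<subseteq> Pow (ground I))"

definition marginal :: "('a, 'b) ssc \<Rightarrow> 'a \<Rightarrow> 'b \<Rightarrow> real" where
  "marginal I F e = measure_pmf.prob (state_pmf I F) {B. e \<in> B}"

text \<open>The joint law of the independent states; outside \<^term>\<open>items I\<close> the state is the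
  default value \<^term>\<open>{}\<close>.\<close>

definition states :: "('a, 'b) ssc \<Rightarrow> ('a \<Rightarrow> 'b set) pmf" where
  "states I = Pi_pmf (items I) {} (state_pmf I)"


section \<open>Adaptive algorithms\<close>

text \<open>An algorithm is a decision tree: \<open>Eval F k\<close> evaluates the item \<open>F\<close> and continues with
  \<open>k B\<close> if the revealed state is \<open>B\<close>. Along a branch an item may be evaluated repeatedly; each
  time it shows the same state. \<open>Randomize\<close> makes an internal random choice, independent of the
  states, so randomized algorithms (and randomized tie-breaking) are covered.\<close>

datatype (alg_items: 'a, dead 'b) alg =
    Stop
  | Eval 'a "'b set \<Rightarrow> ('a, 'b) alg"
  | Randomize "('a, 'b) alg pmf"

text \<open>\<open>evaluated V t\<close> is the law of the set of items that \<open>t\<close> evaluates if the states are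
  given by \<open>V\<close>.\<close>

primrec evaluated :: "('a \<Rightarrow> 'b set) \<Rightarrow> ('a, 'b) alg \<Rightarrow> 'a set pmf" where
  "evaluated V Stop = return_pmf {}"
| "evaluated V (Eval F k) = map_pmf (insert F) (evaluated V (k (V F)))"
| "evaluated V (Randomize p) = join_pmf (map_pmf (evaluated V) p)"

text \<open>In general, a random set of items is given by its conditional law \<open>K V\<close>, given that the
  states are \<open>V\<close>.\<close>

definition outcome :: "('a, 'b) ssc \<Rightarrow> (('a \<Rightarrow> 'b set) \<Rightarrow> 'a set pmf) \<Rightarrow> (('a \<Rightarrow> 'b set) \<times> 'a set) pmf" where
  "outcome I K = bind_pmf (states I) (\<lambda>V. map_pmf (Pair V) (K V))"

definition feasible :: "('a, 'b) ssc \<Rightarrow> (('a \<Rightarrow> 'b set) \<Rightarrow> 'a set pmf) \<Rightarrow> bool" where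
  "feasible I K \<longleftrightarrow>
     measure_pmf.prob (outcome I K) {(V, S). (\<Union>F\<in>S. V F) = (\<Union>F\<in>items I. V F)} = 1"

definition expected_cost :: "('a, 'b) ssc \<Rightarrow> (('a \<Rightarrow> 'b set) \<Rightarrow> 'a set pmf) \<Rightarrow> real" where
  "expected_cost I K = measure_pmf.expectation (outcome I K) (\<lambda>(V, S). \<Sum>F\<in>S. cost I F)"

text \<open>Obliviousness need not be required of an algorithm: lemma \<open>oblivious_evaluated\<close> below
  shows that every decision tree has it.\<close>

definition oblivious :: "('a, 'b) ssc \<Rightarrow> (('a \<Rightarrow> 'b set) \<Rightarrow> 'a set pmf) \<Rightarrow> bool" where
  "oblivious I K \<longleftrightarrow> (\<forall>F\<in>items I. \<forall>B.
     measure_pmf.prob (outcome I K) {(V, S). F \<in> S \<and> V F = B} =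
     measure_pmf.prob (outcome I K) {(V, S). F \<in> S} * pmf (state_pmf I F) B)"

definition feasible_algorithm :: "('a, 'b) ssc \<Rightarrow> ('a, 'b) alg \<Rightarrow> bool" where
  "feasible_algorithm I t \<longleftrightarrow> alg_items t \<subseteq> items I \<and> feasible I (\<lambda>V. evaluated V t)"

definition optimal_algorithm :: "('a, 'b) ssc \<Rightarrow> ('a, 'b) alg \<Rightarrow> bool" where
  "optimal_algorithm I t \<longleftrightarrow> feasible_algorithm I t \<and>
     (\<forall>t'. feasible_algorithm I t' \<longrightarrow>
        expected_cost I (\<lambda>V. evaluated V t) \<le> expected_cost I (\<lambda>V. evaluated V t'))"


section \<open>The greedy algorithm\<close>

definition coverage :: "('a, 'b) ssc \<Rightarrow> 'b set \<Rightarrow> 'a \<Rightarrow> real" where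
  "coverage I U F = (\<Sum>u\<in>U. marginal I F u)"

text \<open>\<open>greedy I A U t\<close>: \<open>t\<close> is a possible continuation of the greedy algorithm when \<open>A\<close> is
  the set of unevaluated items and \<open>U\<close> the set of uncovered elements. Ties may be broken
  depending on the history and at random. Rule \<open>stuck\<close> makes the algorithm total: it gives up
  if no remaining item can cover anything.\<close>

inductive greedy :: "('a, 'b) ssc \<Rightarrow> 'a set \<Rightarrow> 'b set \<Rightarrow> ('a, 'b) alg \<Rightarrow> bool"
  for I :: "('a, 'b) ssc" where
  covered: "greedy I A {} Stop"
| stuck: "U \<noteq> {} \<Longrightarrow> \<forall>F\<in>A. \<not> coverage I U F > 0 \<Longrightarrow> greedy I A U Stop"
| step: "U \<noteq> {} \<Longrightarrow>
    is_arg_min (\<lambda>F. cost I F / coverage I U F) (\<lambda>F. F \<in> A \<and> coverage I U F > 0) F \<Longrightarrow>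
    \<forall>B\<in>set_pmf (state_pmf I F). greedy I (A - {F}) (U - B) (k B) \<Longrightarrow>
    greedy I A U (Eval F k)"
| randomize: "\<forall>t\<in>set_pmf p. greedy I A U t \<Longrightarrow> greedy I A U (Randomize p)"

definition greedy_algorithm :: "('a, 'b) ssc \<Rightarrow> ('a, 'b) alg \<Rightarrow> bool" where
  "greedy_algorithm I t \<longleftrightarrow> greedy I (items I) (ground I) t"


section \<open>The instance on the edges\<close>

definition edges :: "('a, 'b) ssc \<Rightarrow> ('a \<times> 'b) set" where
  "edges I = {(F, e). F \<in> items I \<and> e \<in> ground I \<and> marginal I F e > 0}"

definition edge_state :: "('a, 'b) ssc \<Rightarrow> 'a \<Rightarrow> 'b set \<Rightarrow> ('a \<times> 'b) set" where
  "edge_state I F B = {(F', e) \<in> edges I. F' = F \<or> e \<in> B}"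

definition edge_instance :: "('a, 'b) ssc \<Rightarrow> ('a, 'a \<times> 'b) ssc" where
  "edge_instance I =
     \<lparr>items = items I, ground = edges I, cost = cost I,
      state_pmf = (\<lambda>F. map_pmf (edge_state I F) (state_pmf I F))\<rparr>"

text \<open>The set of items evaluated by an algorithm for the edge instance, when the states of that
  instance are derived from those of \<^term>\<open>I\<close>.\<close>

definition edge_solution :: "('a, 'b) ssc \<Rightarrow> ('a, 'a \<times> 'b) alg \<Rightarrow> ('a \<Rightarrow> 'b set) \<Rightarrow> 'a set pmf" where
  "edge_solution I g V = evaluated (\<lambda>F. edge_state I F (V F)) g"


section \<open>Basic properties\<close>

lemma marginal_edge_instance:
  assumes "(F', e) \<in> edges I"
  shows "marginal (edge_instance I) F (F', e) = (if F' = F then 1 else marginal I F e)"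
  using assms
  by (auto simp: marginal_def edge_instance_def edge_state_def vimage_def)

lemma ssc_instance_edge_instance:
  assumes "ssc_instance I"
  shows "ssc_instance (edge_instance I)"
proof -
  have "edges I \<subseteq> items I \<times> ground I"
    by (auto simp: edges_def)
  moreover have "finite (items I \<times> ground I)"
    using assms by (auto simp: ssc_instance_def)
  ultimately have "finite (edges I)"
    by (rule finite_subset)
  thus ?thesis
    using assms by (auto simp: ssc_instance_def edge_instance_def edge_state_def)
qed

lemma ex_greedy:
  assumes "finite A"
  shows "\<exists>t. greedy I A U t"
  using assms
proof (induction "card A" arbitrary: A U rule: less_induct)
  case less
  let ?P = "\<lambda>F. F \<in> A \<and> coverage I U F > 0"
  consider "U = {}" | "U \<noteq> {}" "\<forall>F\<in>A. \<not> coverage I U F > 0" | "U \<noteq> {}" "\<exists>F. ?P F"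
    by blast
  thus ?case
  proof cases
    case 3
    have "finite {F. ?P F}" "{F. ?P F} \<noteq> {}"
      using 3 less.prems by auto
    then obtain F where F: "is_arg_min (\<lambda>F. cost I F / coverage I U F) ?P F"
      using ex_is_arg_min_if_finite[of "{F. ?P F}" "\<lambda>F. cost I F / coverage I U F"] by auto
    hence "F \<in> A"
      by (simp add: is_arg_min_def)
    hence "\<exists>t. greedy I (A - {F}) (U - B) t" for B
      using less.prems by (intro less.hyps card_Diff1_less) auto
    then obtain k where "\<And>B. greedy I (A - {F}) (U - B) (k B)"
      by metis
    thus ?thesis
      using greedy.step[OF 3(1) F] by blast
  qed (auto intro: greedy.intros)
qed

lemma ex_greedy_algorithm: "ssc_instance I \<Longrightarrow> \<exists>t. greedy_algorithm I t"
  by (simp add: greedy_algorithm_def ssc_instance_def ex_greedy)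

lemma evaluated_subset: "S \<in> set_pmf (evaluated V t) \<Longrightarrow> S \<subseteq> alg_items t"
proof (induction t arbitrary: S)
  case (Eval F k)
  thus ?case by fastforce
qed fastforce+

lemma prob_evaluated_upd:
  "measure_pmf.prob (evaluated (V(F := B)) t) {S. F \<in> S} = measure_pmf.prob (evaluated V t) {S. F \<in> S}"
proof (induction t)
  case (Eval G k)
  show ?case
  proof (cases "G = F")
    case False
    have "insert G -` {S. F \<in> S} = {S. F \<in> S}"
      using False by auto
    thus ?thesis
      using Eval False by auto
  qed (simp add: vimage_def)
next
  case (Randomize p)
  have "measure_pmf.prob (join_pmf (map_pmf (evaluated W) p)) X =
      (\<integral>t. measure_pmf.prob (evaluated W t) X \<partial>measure_pmf p)" for W :: "'a \<Rightarrow> 'b set" and X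
    by (simp flip: bind_eq_join_pmf add: measure_pmf_bind
        measure_pmf.measure_bind[where N = "count_space UNIV"] space_subprob_algebra
        measure_pmf.subprob_space_axioms)
  thus ?case
    using Randomize by (auto intro!: integral_cong_AE simp: AE_measure_pmf_iff)
qed simp

lemma oblivious_evaluated:
  assumes "ssc_instance I"
  shows "oblivious I (\<lambda>V. evaluated V t)"
  unfolding oblivious_def
proof (intro ballI allI)
  fix F B
  assume F: "F \<in> items I"
  have fin: "finite (items I)"
    using assms by (simp add: ssc_instance_def)
  define D where "D = Pi_pmf (items I - {F}) {} (state_pmf I)"
  define \<phi> where "\<phi> = (\<lambda>V. measure_pmf.prob (evaluated V t) {S. F \<in> S})"
  have prob_bind: "measure_pmf.prob (bind_pmf p f) X = (\<integral>x. measure_pmf.prob (f x) X \<partial>measure_pmf p)"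
    for p :: "'x pmf" and f :: "'x \<Rightarrow> 'y pmf" and X
    by (simp add: measure_pmf_bind measure_pmf.measure_bind[where N = "count_space UNIV"]
        space_subprob_algebra measure_pmf.subprob_space_axioms)
  have st: "states I = do {y \<leftarrow> state_pmf I F; f \<leftarrow> D; return_pmf (f(F := y))}"
    using Pi_pmf_insert'[of "items I - {F}" F "{}" "state_pmf I"] fin F
    by (simp add: states_def D_def insert_absorb)
  have out: "outcome I (\<lambda>V. evaluated V t) =
      do {y \<leftarrow> state_pmf I F; f \<leftarrow> D; map_pmf (Pair (f(F := y))) (evaluated (f(F := y)) t)}"
    by (simp add: outcome_def st bind_assoc_pmf bind_return_pmf)
  have a: "measure_pmf.prob (outcome I (\<lambda>V. evaluated V t)) {(V, S). F \<in> S} = (\<integral>f. \<phi> f \<partial>measure_pmf D)"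
    by (simp add: out prob_bind vimage_def prob_evaluated_upd \<phi>_def)
  have "measure_pmf.prob (outcome I (\<lambda>V. evaluated V t)) {(V, S). F \<in> S \<and> V F = B} =
      (\<integral>y. \<integral>f. indicator {B} y * \<phi> f \<partial>measure_pmf D \<partial>measure_pmf (state_pmf I F))"
    unfolding out prob_bind
    by (intro Bochner_Integration.integral_cong refl)
      (auto simp: vimage_def prob_evaluated_upd \<phi>_def indicator_def)
  also have "\<dots> = (\<integral>f. \<phi> f \<partial>measure_pmf D) * pmf (state_pmf I F) B"
    by (simp add: measure_pmf_single)
  finally show "measure_pmf.prob (outcome I (\<lambda>V. evaluated V t)) {(V, S). F \<in> S \<and> V F = B} =
      measure_pmf.prob (outcome I (\<lambda>V. evaluated V t)) {(V, S). F \<in> S} * pmf (state_pmf I F) B"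
    by (simp add: a)
qed

lemma feasible_iff:
  "feasible I K \<longleftrightarrow>
     (\<forall>V\<in>set_pmf (states I). \<forall>S\<in>set_pmf (K V). (\<Union>F\<in>S. V F) = (\<Union>F\<in>items I. V F))"
  by (auto simp: feasible_def measure_pmf.prob_eq_1 AE_measure_pmf_iff outcome_def)

lemma finite_states:
  assumes "ssc_instance I"
  shows "finite (set_pmf (states I))"
proof -
  have fin: "finite (items I)"
    and "\<And>F. F \<in> items I \<Longrightarrow> finite (set_pmf (state_pmf I F))"
    using assms by (auto simp: ssc_instance_def intro: finite_subset)
  hence "finite (PiE_dflt (items I) {} (set_pmf \<circ> state_pmf I))"
    by (intro finite_PiE_dflt) auto
  thus ?thesis
    using fin by (simp add: states_def set_Pi_pmf)
qed

lemma expected_cost_evaluated: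
  assumes "ssc_instance I" "alg_items t \<subseteq> items I"
  shows "expected_cost I (\<lambda>V. evaluated V t) =
    (\<Sum>V\<in>set_pmf (states I). measure_pmf.expectation (evaluated V t)
       (\<lambda>S. pmf (states I) V * (\<Sum>F\<in>S. cost I F)))"
proof -
  have "finite (items I)"
    using assms by (auto simp: ssc_instance_def)
  hence "finite (set_pmf (evaluated V t))" for V
    by (rule finite_subset[rotated, OF finite_Pow_iff[THEN iffD2]])
      (use assms evaluated_subset in blast)
  thus ?thesis
    unfolding expected_cost_def outcome_def
    by (subst pmf_expectation_bind[OF finite_states[OF assms(1)]]) auto
qed

text \<open>Derandomization: for any loss \<open>L\<close> and any condition \<open>ok\<close> that holds surely, a
  randomized algorithm can be replaced by a deterministic one.\<close>

lemma derandomize: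
  assumes "finite A" "alg_items t \<subseteq> A" "finite X"
    and "\<And>V S. V \<in> X \<Longrightarrow> S \<in> set_pmf (evaluated V t) \<Longrightarrow> ok V S"
  shows "\<exists>t' d. alg_items t' \<subseteq> A \<and> (\<forall>V. evaluated V t' = return_pmf (d V)) \<and>
    (\<forall>V\<in>X. ok V (d V)) \<and>
    (\<Sum>V\<in>X. L V (d V)) \<le> (\<Sum>V\<in>X. measure_pmf.expectation (evaluated V t) (L V :: _ \<Rightarrow> real))"
  using assms(2-)
proof (induction t arbitrary: X ok L)
  case Stop
  thus ?case
    by (intro exI[of _ Stop] exI[of _ "\<lambda>_. {}"]) auto
next
  case (Eval F k)
  have sub: "alg_items (k B) \<subseteq> A" for B
    using Eval.prems(1) by (auto simp: UN_subset_iff)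
  define XB where "XB = (\<lambda>B. {V \<in> X. V F = B})"
  have "\<forall>B. \<exists>t' d. alg_items t' \<subseteq> A \<and> (\<forall>V. evaluated V t' = return_pmf (d V)) \<and>
    (\<forall>V\<in>XB B. ok V (insert F (d V))) \<and>
    (\<Sum>V\<in>XB B. L V (insert F (d V))) \<le>
    (\<Sum>V\<in>XB B. measure_pmf.expectation (evaluated V (k B)) (\<lambda>S. L V (insert F S)))"
    using Eval.prems(2,3) sub
    by (intro allI Eval.IH[where ok = "\<lambda>V S. ok V (insert F S)" and L = "\<lambda>V S. L V (insert F S)"])
      (auto simp: XB_def)
  then obtain t' d where td: "\<And>B. alg_items (t' B) \<subseteq> A"
    "\<And>B V. evaluated V (t' B) = return_pmf (d B V)"
    "\<And>B V. V \<in> XB B \<Longrightarrow> ok V (insert F (d B V))"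
    "\<And>B. (\<Sum>V\<in>XB B. L V (insert F (d B V))) \<le>
      (\<Sum>V\<in>XB B. measure_pmf.expectation (evaluated V (k B)) (\<lambda>S. L V (insert F S)))"
    unfolding choice_iff by blast
  have "(\<Sum>V\<in>X. L V (insert F (d (V F) V))) =
      (\<Sum>B\<in>(\<lambda>V. V F) ` X. \<Sum>V\<in>XB B. L V (insert F (d (V F) V)))"
    unfolding XB_def by (rule sum.image_gen[OF Eval.prems(2)])
  also have "\<dots> = (\<Sum>B\<in>(\<lambda>V. V F) ` X. \<Sum>V\<in>XB B. L V (insert F (d B V)))"
    by (intro sum.cong) (auto simp: XB_def)
  also have "\<dots> \<le> (\<Sum>B\<in>(\<lambda>V. V F) ` X. \<Sum>V\<in>XB B.
      measure_pmf.expectation (evaluated V (k B)) (\<lambda>S. L V (insert F S)))"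
    by (intro sum_mono td)
  also have "\<dots> = (\<Sum>B\<in>(\<lambda>V. V F) ` X. \<Sum>V\<in>XB B.
      measure_pmf.expectation (evaluated V (k (V F))) (\<lambda>S. L V (insert F S)))"
    by (intro sum.cong) (auto simp: XB_def)
  also have "\<dots> = (\<Sum>V\<in>X. measure_pmf.expectation (evaluated V (k (V F))) (\<lambda>S. L V (insert F S)))"
    unfolding XB_def by (rule sum.image_gen[OF Eval.prems(2), symmetric])
  finally show ?case
    using td Eval.prems
    by (intro exI[of _ "Eval F t'"] exI[of _ "\<lambda>V. insert F (d (V F) V)"]) (auto simp: XB_def)
next
  case (Randomize p)
  define G where "G = (\<lambda>t. \<Sum>V\<in>X. \<Sum>S\<in>Pow A. L V S * pmf (evaluated V t) S)"
  have expect: "measure_pmf.expectation (evaluated V t) (L V) =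
      (\<Sum>S\<in>Pow A. L V S * pmf (evaluated V t) S)" if "alg_items t \<subseteq> A" for t V
    using \<open>finite A\<close> that evaluated_subset[of _ V t]
    by (subst integral_measure_pmf_real[where A = "Pow A"]) fastforce+
  have int: "integrable (measure_pmf p) (\<lambda>t. pmf (evaluated V t) S)" for V S
    by (intro measure_pmf.integrable_const_bound[where B = 1]) (auto simp: pmf_le_1)
  have intG: "integrable (measure_pmf p) G"
    unfolding G_def
    by (intro Bochner_Integration.integrable_sum integrable_mult_right int)
  have EG: "measure_pmf.expectation p G =
      (\<Sum>V\<in>X. measure_pmf.expectation (evaluated V (Randomize p)) (L V))"
    unfolding G_def expect[OF Randomize.prems(1)]
    by (simp add: int pmf_join)
  have "\<exists>t\<in>set_pmf p. G t \<le> measure_pmf.expectation p G"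
  proof (rule ccontr)
    assume "\<not> ?thesis"
    hence "AE t in measure_pmf p. - G t < - measure_pmf.expectation p G"
      by (auto simp: AE_measure_pmf_iff not_le)
    hence "measure_pmf.expectation p (\<lambda>t. - G t) < - measure_pmf.expectation p G"
      using intG by (intro measure_pmf.expectation_less) auto
    thus False
      by simp
  qed
  then obtain t where t: "t \<in> set_pmf p" "G t \<le> measure_pmf.expectation p G"
    by blast
  have tA: "alg_items t \<subseteq> A"
    using t Randomize.prems by auto
  have Gt: "G t = (\<Sum>V\<in>X. measure_pmf.expectation (evaluated V t) (L V))"
    unfolding G_def expect[OF tA] ..
  have "\<exists>t' d. alg_items t' \<subseteq> A \<and> (\<forall>V. evaluated V t' = return_pmf (d V)) \<and>
    (\<forall>V\<in>X. ok V (d V)) \<and>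
    (\<Sum>V\<in>X. L V (d V)) \<le> (\<Sum>V\<in>X. measure_pmf.expectation (evaluated V t) (L V))"
    using t(1) tA Randomize.prems(2)
    by (intro Randomize.IH) (auto intro!: Randomize.prems(3))
  thus ?case
    using t EG Gt by (metis order_trans)
qed

lemma ex_optimal_algorithm:
  assumes I: "ssc_instance I"
  shows "\<exists>t. optimal_algorithm I t"
proof -
  let ?X = "set_pmf (states I)" and ?A = "items I"
  define val where "val = (\<lambda>d. \<Sum>V\<in>?X. pmf (states I) V * (\<Sum>F\<in>d V. cost I F))"
  define M where "M = {d. \<exists>t. feasible_algorithm I t \<and> (\<forall>V. evaluated V t = return_pmf (d V))}"
  have fin: "finite ?A"
    using I by (simp add: ssc_instance_def)
  have cost_val: "expected_cost I (\<lambda>V. evaluated V t) = val d"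
    if "feasible_algorithm I t" "\<And>V. evaluated V t = return_pmf (d V)" for t d
  proof -
    have "alg_items t \<subseteq> ?A"
      using that(1) by (simp add: feasible_algorithm_def)
    from expected_cost_evaluated[OF I this] show ?thesis
      by (simp add: that(2) val_def cong: sum.cong_simp)
  qed
  have det: "\<exists>d\<in>M. val d \<le> expected_cost I (\<lambda>V. evaluated V t)" if t: "feasible_algorithm I t" for t
  proof -
    have "\<exists>t' d. alg_items t' \<subseteq> ?A \<and> (\<forall>V. evaluated V t' = return_pmf (d V)) \<and>
      (\<forall>V\<in>?X. (\<Union>F\<in>d V. V F) = (\<Union>F\<in>?A. V F)) \<and>
      (\<Sum>V\<in>?X. pmf (states I) V * (\<Sum>F\<in>d V. cost I F)) \<le>
      (\<Sum>V\<in>?X. measure_pmf.expectation (evaluated V t) (\<lambda>S. pmf (states I) V * (\<Sum>F\<in>S. cost I F)))"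
      using t fin finite_states[OF I]
      by (intro derandomize[where ok = "\<lambda>V S. (\<Union>F\<in>S. V F) = (\<Union>F\<in>?A. V F)"
            and L = "\<lambda>V S. pmf (states I) V * (\<Sum>F\<in>S. cost I F)"])
        (auto simp: feasible_algorithm_def feasible_iff)
    then obtain t' d where d: "alg_items t' \<subseteq> ?A" "\<And>V. evaluated V t' = return_pmf (d V)"
      "\<forall>V\<in>?X. (\<Union>F\<in>d V. V F) = (\<Union>F\<in>?A. V F)" "val d \<le> expected_cost I (\<lambda>V. evaluated V t)"
      using t by (auto simp: val_def feasible_algorithm_def expected_cost_evaluated[OF I])
    have "feasible_algorithm I t'"
      using d by (simp add: feasible_algorithm_def feasible_iff)
    hence "d \<in> M"
      using d(2) by (auto simp: M_def)
    thus ?thesis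
      using d(4) by blast
  qed
  have "val ` M \<subseteq> val ` (?X \<rightarrow>\<^sub>E Pow ?A)"
  proof (rule image_subsetI)
    fix d
    assume "d \<in> M"
    then obtain t where t: "alg_items t \<subseteq> ?A" "\<And>V. evaluated V t = return_pmf (d V)"
      by (auto simp: M_def feasible_algorithm_def)
    have "d V \<subseteq> ?A" for V
      using evaluated_subset[of "d V" V t] t by auto
    hence "restrict d ?X \<in> ?X \<rightarrow>\<^sub>E Pow ?A"
      by auto
    moreover have "val d = val (restrict d ?X)"
      by (simp add: val_def)
    ultimately show "val d \<in> val ` (?X \<rightarrow>\<^sub>E Pow ?A)"
      by blast
  qed
  hence finM: "finite (val ` M)"
    by (rule finite_subset) (intro finite_imageI finite_PiE finite_states I, use fin in simp)
  have "\<exists>t. feasible_algorithm I t"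
  proof -
    obtain xs where xs: "set xs = ?A"
      using fin finite_list by blast
    define t :: "('a, 'b) alg" where "t = foldr (\<lambda>F t. Eval F (\<lambda>_. t)) xs Stop"
    have "evaluated V (foldr (\<lambda>F t. Eval F (\<lambda>_. t)) ys Stop) = return_pmf (set ys)"
      "alg_items (foldr (\<lambda>F t. Eval F (\<lambda>_. t)) ys (Stop :: ('a, 'b) alg)) = set ys"
      for V :: "'a \<Rightarrow> 'b set" and ys
      by (induction ys) auto
    hence "feasible_algorithm I t"
      by (simp add: feasible_algorithm_def feasible_iff t_def xs)
    thus ?thesis ..
  qed
  hence "val ` M \<noteq> {}"
    using det by blast
  hence "Min (val ` M) \<in> val ` M"
    using finM by (rule Min_in[rotated])
  then obtain d where d: "d \<in> M" "val d = Min (val ` M)"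
    by (metis imageE)
  then obtain t where t: "feasible_algorithm I t" "\<And>V. evaluated V t = return_pmf (d V)"
    by (auto simp: M_def)
  have "val d \<le> expected_cost I (\<lambda>V. evaluated V t')" if t': "feasible_algorithm I t'" for t'
  proof -
    obtain d' where d': "d' \<in> M" "val d' \<le> expected_cost I (\<lambda>V. evaluated V t')"
      using det[OF t'] by blast
    have "val d \<le> val d'"
      unfolding d(2) using finM d'(1) by (intro Min_le) auto
    thus ?thesis
      using d'(2) by linarith
  qed
  hence "optimal_algorithm I t"
    unfolding optimal_algorithm_def cost_val[OF t] using t(1) by blast
  thus ?thesis ..
qed

end

theory Submission
  imports Defs
begin

text \<open>Fix a feasible algorithm \<open>T\<close> and let \<open>x\<^sub>F(V)\<close> be the probability that it evaluates \<open>F\<close> when the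
  states are \<open>V\<close>; obliviousness says that \<open>x\<^sub>F(V)\<close> does not depend on \<open>V F\<close>. By induction along
  the greedy tree, the expected cost of greedy on an uncovered set \<open>U\<close> of size \<open>n\<close> is at most
  \<open>H(n) \<Sum>\<^sub>F C(F) E[x\<^sub>F]\<close>, for every family \<open>x\<close> that covers \<open>U\<close> fractionally in every
  realization. When greedy evaluates \<open>F\<^sub>1\<close> at price \<open>\<rho>\<close> per expected new element and \<open>k\<close>
  elements get covered, each other item \<open>F\<close> has \<open>C(F) \<ge> \<rho> E|V(F) \<inter> U|\<close> and its coefficient drops by
  \<open>H(n) - H(n - k) \<ge> k/n\<close>, whereas \<open>F\<^sub>1\<close> itself loses its whole coefficient \<open>H(n) \<ge> 1 \<ge> |V(F\<^sub>1) \<inter> U|/n\<close>.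
  By independence the bound drops by at least
  \<open>\<rho> E[(k/n) \<Sum>\<^sub>F x\<^sub>F |V(F) \<inter> U|] \<ge> \<rho> E[k] = C(F\<^sub>1)\<close>.
  Applied to the edge instance, this needs only that \<open>T\<close> covers every edge \<open>(F, e)\<close>: if \<open>T\<close> stopped
  without evaluating \<open>F\<close> and without covering \<open>e\<close>, resampling the state of \<open>F\<close> would make it fail
  with positive probability.\<close>

section \<open>Product laws and harmonic numbers\<close>

text \<open>Fubini for one coordinate. Under the inner law coordinate \<open>F\<close> has the
  default value \<open>d\<close>, which the update overwrites.\<close>

lemma expectation_Pi_pmf_remove:
  fixes h :: "('a \<Rightarrow> 's) \<Rightarrow> real"
  assumes "finite A" "F \<in> A" "\<And>G. G \<in> A \<Longrightarrow> finite (set_pmf (q G))"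
  shows "measure_pmf.expectation (Pi_pmf A d q) h =
    measure_pmf.expectation (q F)
      (\<lambda>b. measure_pmf.expectation (Pi_pmf (A - {F}) d q) (\<lambda>V. h (V(F := b))))"
proof -
  have fin: "finite (set_pmf (Pi_pmf (A - {F}) d q))"
    using assms by (subst set_Pi_pmf) (auto intro!: finite_PiE_dflt)
  have "Pi_pmf A d q =
      do {b \<leftarrow> q F; map_pmf (\<lambda>V. V(F := b)) (Pi_pmf (A - {F}) d q)}"
    using Pi_pmf_insert'[of "A - {F}" F d q] assms by (simp add: insert_absorb map_pmf_def)
  thus ?thesis
    using assms fin
    by (simp add: pmf_expectation_bind[of "set_pmf (q F)"] integral_measure_pmf[of "set_pmf (q F)"])
qed

lemma integrable_Pi_pmf_finite:
  fixes h :: "('a \<Rightarrow> 's) \<Rightarrow> real"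
  assumes "finite A" "\<And>G. G \<in> A \<Longrightarrow> finite (set_pmf (q G))"
  shows "integrable (measure_pmf (Pi_pmf A d q)) h"
  using assms by (intro integrable_measure_pmf_finite) (simp add: set_Pi_pmf finite_PiE_dflt)

text \<open>Independence enters here: \<open>\<phi>\<close> ignores coordinate \<open>F\<close>, as
  an oblivious evaluation probability does, so it is independent of \<open>V F\<close> and the
  expectation factors.\<close>

lemma expectation_Pi_pmf_mult_indep:
  fixes \<phi> :: "('a \<Rightarrow> 's) \<Rightarrow> real" and \<psi> :: "'s \<Rightarrow> real"
  assumes "finite A" "F \<in> A" "\<And>G. G \<in> A \<Longrightarrow> finite (set_pmf (q G))"
    and "\<And>V b. \<phi> (V(F := b)) = \<phi> V"
  shows "measure_pmf.expectation (Pi_pmf A d q) (\<lambda>V. \<phi> V * \<psi> (V F)) =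
    measure_pmf.expectation (Pi_pmf A d q) \<phi> * measure_pmf.expectation (q F) \<psi>"
  using assms by (simp add: expectation_Pi_pmf_remove[OF assms(1-3)])

text \<open>Each of the \<open>k\<close> terms dropped from \<open>harm n\<close> is at least
  \<open>1/n\<close>.\<close>

lemma harm_diff_le:
  assumes "k \<le> n"
  shows "harm (n - k) \<le> harm n - real k / real n"
  using assms
proof (induction k)
  case (Suc k)
  define m where "m = n - Suc k"
  have m: "n - k = Suc m" "Suc m \<le> n"
    using Suc.prems by (auto simp: m_def)
  have "1 / real n \<le> 1 / real (Suc m)"
    using m by (intro divide_left_mono) auto
  moreover have "harm (Suc m) \<le> harm n - real k / real n"
    using Suc m(1) by simp
  ultimately show ?case
    by (simp add: harm_Suc m_def[symmetric] add_divide_distrib inverse_eq_divide)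
qed simp

lemma prob_bind_pmf:
  "measure_pmf.prob (bind_pmf p f) X = (\<integral>x. measure_pmf.prob (f x) X \<partial>measure_pmf p)"
  by (simp add: measure_pmf_bind measure_pmf.measure_bind[where N = "count_space UNIV"]
      space_subprob_algebra measure_pmf.subprob_space_axioms)

section \<open>Runs of a greedy tree\<close>

text \<open>Rule \<open>step\<close> constrains \<open>k B\<close> only for states \<open>B\<close>
  of positive probability, so \<open>W\<close> has to stay in the supports; elsewhere the tree is
  arbitrary.\<close>

lemma greedy_evaluated_subset:
  assumes "greedy J A U t" "\<And>F. F \<in> A \<Longrightarrow> W F \<in> set_pmf (state_pmf J F)"
    and "S \<in> set_pmf (evaluated W t)"
  shows "S \<subseteq> A"
  using assms
proof (induction arbitrary: S rule: greedy.induct)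
  case (step U A F k)
  from step.prems(2) obtain S' where S': "S' \<in> set_pmf (evaluated W (k (W F)))" "S = insert F S'"
    by auto
  have F: "F \<in> A"
    using step.hyps(2) by (simp add: is_arg_min_def)
  have "S' \<subseteq> A - {F}"
    using step.IH F step.prems(1) S'(1) by blast
  thus ?case
    using F S'(2) by blast
qed auto

text \<open>A run queries only items of \<open>A\<close>. Hence the subtree below \<open>F\<close>
  does not notice how the state of \<open>F\<close> is set.\<close>

lemma greedy_evaluated_cong:
  assumes "greedy J A U t" "\<And>F. F \<in> A \<Longrightarrow> W F \<in> set_pmf (state_pmf J F)"
    and "\<And>F. F \<in> A \<Longrightarrow> W' F = W F"
  shows "evaluated W' t = evaluated W t"
  using assms
proof (induction rule: greedy.induct)
  case (step U A F k)
  have F: "F \<in> A"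
    using step.hyps(2) by (simp add: is_arg_min_def)
  have "evaluated W' (k (W F)) = evaluated W (k (W F))"
    using step.IH F step.prems by blast
  thus ?case
    using F step.prems(2) by simp
next
  case (randomize p A U)
  hence "map_pmf (evaluated W') p = map_pmf (evaluated W) p"
    by (intro map_pmf_cong) auto
  thus ?case
    by simp
qed auto

section \<open>Greedy cost against a fractional cover\<close>

lemma coverage_eq_expectation:
  assumes "finite U" "finite (set_pmf p)" "state_pmf J F = map_pmf s p"
  shows "coverage J U F = measure_pmf.expectation p (\<lambda>b. real (card (U \<inter> s b)))"
proof -
  have "real (card (U \<inter> s b)) = (\<Sum>u\<in>U. indicator {b. u \<in> s b} b)" for b
    using assms(1) by (simp add: indicator_def sum.If_cases)
  hence "measure_pmf.expectation p (\<lambda>b. real (card (U \<inter> s b))) =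
      (\<Sum>u\<in>U. measure_pmf.prob p {b. u \<in> s b})"
    using assms(2) by (simp add: Bochner_Integration.integral_sum integrable_measure_pmf_finite)
  thus ?thesis
    using assms(3) by (simp add: coverage_def marginal_def vimage_def)
qed

text \<open>The states of \<open>J\<close> may be coarsenings \<open>s F\<close> of the underlying ones: in the edge instance
  \<^const>\<open>edge_state\<close> loses information that the competing algorithm, and hence \<open>x\<close>, may use.\<close>

lemma greedy_cost_le:
  fixes x :: "'a \<Rightarrow> ('a \<Rightarrow> 's) \<Rightarrow> real" and J :: "('a, 'c) ssc"
  assumes "greedy J A U t" "finite A" "finite U"
    and "\<And>F. F \<in> A \<Longrightarrow> state_pmf J F = map_pmf (s F) (q F)"
    and "\<And>F. F \<in> A \<Longrightarrow> finite (set_pmf (q F))"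
    and "\<And>F. F \<in> A \<Longrightarrow> 0 \<le> cost J F"
    and "\<And>F V. F \<in> A \<Longrightarrow> 0 \<le> x F V"
    and "\<And>F V b. F \<in> A \<Longrightarrow> x F (V(F := b)) = x F V"
    and "\<And>V u. V \<in> set_pmf (Pi_pmf A d q) \<Longrightarrow> u \<in> U \<Longrightarrow> 1 \<le> (\<Sum>F | F \<in> A \<and> u \<in> s F (V F). x F V)"
  shows "measure_pmf.expectation (Pi_pmf A d q)
      (\<lambda>V. \<Sum>F\<in>A. cost J F * measure_pmf.prob (evaluated (\<lambda>F. s F (V F)) t) {S. F \<in> S}) \<le>
    harm (card U) * (\<Sum>F\<in>A. cost J F * measure_pmf.expectation (Pi_pmf A d q) (x F))"
  using assms
proof (induction arbitrary: x rule: greedy.induct)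
  case (covered A)
  thus ?case
    by (simp add: harm_expand)
next
  case (stuck U A)
  thus ?case
    by (auto intro!: mult_nonneg_nonneg harm_nonneg sum_nonneg integral_nonneg)
next
  case (randomize p A U)
  let ?D = "Pi_pmf A d q"
  let ?P = "\<lambda>F V t. measure_pmf.prob (evaluated (\<lambda>F. s F (V F)) t) {S. F \<in> S}"
  let ?B = "harm (card U) * (\<Sum>F\<in>A. cost J F * measure_pmf.expectation ?D (x F))"
  have fin: "finite (set_pmf ?D)"
    using randomize.prems by (simp add: set_Pi_pmf finite_PiE_dflt)
  have int: "integrable (measure_pmf p) (?P F V)" for F V
    by (intro measure_pmf.integrable_const_bound[where B = 1]) auto
  \<comment> \<open>As a finite sum over states, \<open>\<gamma>\<close> is linear in the evaluation
    probabilities, so averaging over the internal choice \<open>p\<close> commutes with it.\<close>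
  define \<gamma> where "\<gamma> = (\<lambda>t. \<Sum>V\<in>set_pmf ?D. pmf ?D V * (\<Sum>F\<in>A. cost J F * ?P F V t))"
  have \<gamma>: "\<gamma> t = measure_pmf.expectation ?D (\<lambda>V. \<Sum>F\<in>A. cost J F * ?P F V t)" for t
    using fin by (simp add: \<gamma>_def integral_measure_pmf[of "set_pmf ?D"])
  have int\<gamma>: "integrable (measure_pmf p) \<gamma>"
    unfolding \<gamma>_def by (intro Bochner_Integration.integrable_sum integrable_mult_right int)
  have "\<gamma> (Randomize p) = measure_pmf.expectation p \<gamma>"
    unfolding \<gamma>_def by (simp add: int prob_bind_pmf flip: bind_eq_join_pmf)
  also have "\<dots> \<le> measure_pmf.expectation p (\<lambda>_. ?B)"
  proof (intro integral_mono_AE int\<gamma>)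
    show "AE t in measure_pmf p. \<gamma> t \<le> ?B"
      unfolding \<gamma> AE_measure_pmf_iff
    proof
      fix t
      assume "t \<in> set_pmf p"
      with randomize show "measure_pmf.expectation ?D (\<lambda>V. \<Sum>F\<in>A. cost J F * ?P F V t) \<le> ?B"
        by blast
    qed
  qed simp
  finally show ?case
    by (simp add: \<gamma>)
next
  case (step U A F k)
  note fin = step.prems(1,2) and st = step.prems(3) and finq = step.prems(4) and c0 = step.prems(5)
    and x0 = step.prems(6) and xupd = step.prems(7) and xcov = step.prems(8)
  let ?E = "measure_pmf.expectation (Pi_pmf A d q)"
  let ?E' = "measure_pmf.expectation (Pi_pmf (A - {F}) d q)"
  let ?P = "\<lambda>G V t. measure_pmf.prob (evaluated (\<lambda>F. s F (V F)) t) {S. G \<in> S}"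
  define m where "m = (\<lambda>G V. real (card (U \<inter> s G (V G))))"
  define n where "n = real (card U)"
  define \<rho> where "\<rho> = cost J F / coverage J U F"
  have F: "F \<in> A" and R: "coverage J U F > 0"
    and \<rho>_le: "\<And>G. G \<in> A \<Longrightarrow> coverage J U G > 0 \<Longrightarrow> \<rho> \<le> cost J G / coverage J U G"
    using step.hyps(2) by (auto simp: is_arg_min_linorder \<rho>_def)
  have n: "n > 0"
    using step.hyps(1) fin by (simp add: n_def card_gt_0_iff)
  have \<rho>0: "\<rho> \<ge> 0"
    using c0[OF F] R by (simp add: \<rho>_def)
  have cov: "coverage J U G = measure_pmf.expectation (q G) (\<lambda>b. real (card (U \<inter> s G b)))"
    if "G \<in> A" for G
    using fin(2) finq[OF that] st[OF that] by (rule coverage_eq_expectation)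
  \<comment> \<open>Greedy compares only items of positive coverage; for the others the right side
    is at most 0.\<close>
  have c_ge: "cost J G \<ge> \<rho> * coverage J U G" if "G \<in> A" for G
  proof (cases "coverage J U G > 0")
    case True
    thus ?thesis
      using \<rho>_le[OF that] by (simp add: pos_le_divide_eq)
  next
    case False
    thus ?thesis
      using c0[OF that] \<rho>0 by (meson mult_nonneg_nonpos not_le order_trans less_imp_le)
  qed
  have cF: "cost J F = \<rho> * coverage J U F"
    using R by (simp add: \<rho>_def)
  have int: "integrable (measure_pmf (Pi_pmf A d q)) h" for h :: "_ \<Rightarrow> real"
    using fin(1) finq by (rule integrable_Pi_pmf_finite)
  have int': "integrable (measure_pmf (Pi_pmf (A - {F}) d q)) h" for h :: "_ \<Rightarrow> real"
    using fin(1) finq by (intro integrable_Pi_pmf_finite) auto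
  have m0: "0 \<le> m G V" and mn: "m G V \<le> n" for G V
    using fin(2) by (auto simp: m_def n_def intro: card_mono)
  have indep: "?E (\<lambda>V. \<phi> V * m G V) = ?E \<phi> * coverage J U G"
    if "G \<in> A" "\<And>V b. \<phi> (V(G := b)) = \<phi> V" for G \<phi>
    unfolding m_def cov[OF that(1)]
    by (rule expectation_Pi_pmf_mult_indep[OF fin(1) that(1) finq that(2)])

  \<comment> \<open>Condition on the state \<open>b\<close> of \<open>F\<close>. The induction
    hypothesis is used with the cover \<open>x G (V(F := b))\<close>, in which \<open>F\<close> no
    longer takes part.\<close>
  have after: "?E' (\<lambda>V. \<Sum>G\<in>A - {F}. cost J G * ?P G (V(F := b)) (k (s F b))) \<le>
      harm (card (U - s F b)) * (\<Sum>G\<in>A - {F}. cost J G * ?E' (\<lambda>V. x G (V(F := b))))"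
    if b: "b \<in> set_pmf (q F)" for b
  proof -
    have g: "greedy J (A - {F}) (U - s F b) (k (s F b))"
      using step.IH st[OF F] b by auto
    have "?E' (\<lambda>V. \<Sum>G\<in>A - {F}. cost J G * ?P G (V(F := b)) (k (s F b))) =
        ?E' (\<lambda>V. \<Sum>G\<in>A - {F}. cost J G * ?P G V (k (s F b)))"
    proof (intro integral_cong_AE AE_pmfI)
      fix V
      assume "V \<in> set_pmf (Pi_pmf (A - {F}) d q)"
      hence V: "V G \<in> set_pmf (q G)" if "G \<in> A - {F}" for G
        using fin(1) that by (auto simp: set_Pi_pmf PiE_dflt_def)
      have "evaluated (\<lambda>G. s G ((V(F := b)) G)) (k (s F b)) = evaluated (\<lambda>G. s G (V G)) (k (s F b))"
        by (rule greedy_evaluated_cong[OF g]) (use V st in auto)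
      thus "(\<Sum>G\<in>A - {F}. cost J G * ?P G (V(F := b)) (k (s F b))) =
          (\<Sum>G\<in>A - {F}. cost J G * ?P G V (k (s F b)))"
        by simp
    qed simp_all
    also have "\<dots> \<le> harm (card (U - s F b)) * (\<Sum>G\<in>A - {F}. cost J G * ?E' (\<lambda>V. x G (V(F := b))))"
    proof -
      have sb: "s F b \<in> set_pmf (state_pmf J F)"
        using st[OF F] b by simp
      have "1 \<le> (\<Sum>G | G \<in> A - {F} \<and> u \<in> s G (V G). x G (V(F := b)))"
        if V: "V \<in> set_pmf (Pi_pmf (A - {F}) d q)" and u: "u \<in> U - s F b" for V u
      proof -
        have "V(F := b) \<in> set_pmf (Pi_pmf A d q)"
          using V F b fin(1) by (auto simp: set_Pi_pmf PiE_dflt_def)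
        hence "1 \<le> (\<Sum>G | G \<in> A \<and> u \<in> s G ((V(F := b)) G). x G (V(F := b)))"
          using xcov u by blast
        \<comment> \<open>Since \<open>u\<close> is not in \<open>s F b\<close>, \<open>F\<close>
          contributes nothing to the covering of \<open>u\<close>.\<close>
        also have "{G. G \<in> A \<and> u \<in> s G ((V(F := b)) G)} = {G. G \<in> A - {F} \<and> u \<in> s G (V G)}"
          using u by auto
        finally show ?thesis .
      qed
      moreover have "x G (V(G := b', F := b)) = x G (V(F := b))" if "G \<in> A - {F}" for G V b'
        by (subst fun_upd_twist) (use that in \<open>auto intro!: xupd simp del: fun_upd_apply\<close>)
      ultimately show ?thesis
        using fin st finq c0 x0
        by (intro step.IH[THEN bspec[OF _ sb], THEN conjunct2, rule_format,
              where x = "\<lambda>G V. x G (V(F := b))"]) auto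
    qed
    finally show ?thesis .
  qed

  have "?E (\<lambda>V. \<Sum>G\<in>A. cost J G * ?P G V (Eval F k)) =
      ?E (\<lambda>V. cost J F + (\<Sum>G\<in>A - {F}. cost J G * ?P G V (k (s F (V F)))))"
  proof (intro Bochner_Integration.integral_cong refl)
    fix V
    have "?P G V (Eval F k) = ?P G V (k (s F (V F)))" if "G \<noteq> F" for G
      using that by (simp add: vimage_def)
    thus "(\<Sum>G\<in>A. cost J G * ?P G V (Eval F k)) =
        cost J F + (\<Sum>G\<in>A - {F}. cost J G * ?P G V (k (s F (V F))))"
      using F fin(1) by (subst sum.remove[of A F]) (auto simp: vimage_def intro!: sum.cong)
  qed
  also have "\<dots> = cost J F + ?E (\<lambda>V. \<Sum>G\<in>A - {F}. cost J G * ?P G V (k (s F (V F))))"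
    by (simp add: int)
  also have "?E (\<lambda>V. \<Sum>G\<in>A - {F}. cost J G * ?P G V (k (s F (V F)))) =
      measure_pmf.expectation (q F)
        (\<lambda>b. ?E' (\<lambda>V. \<Sum>G\<in>A - {F}. cost J G * ?P G (V(F := b)) (k (s F b))))"
    by (simp add: expectation_Pi_pmf_remove[OF fin(1) F finq])
  also have "\<dots> \<le> measure_pmf.expectation (q F)
      (\<lambda>b. harm (card (U - s F b)) * (\<Sum>G\<in>A - {F}. cost J G * ?E' (\<lambda>V. x G (V(F := b)))))"
    using after finq[OF F]
    by (intro integral_mono_AE integrable_measure_pmf_finite) (auto simp: AE_measure_pmf_iff)
  also have "\<dots> = ?E (\<lambda>V. harm (card (U - s F (V F))) * (\<Sum>G\<in>A - {F}. cost J G * x G V))"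
    by (simp add: expectation_Pi_pmf_remove[OF fin(1) F finq] int')
  \<comment> \<open>\<open>harm_diff_le\<close> with \<open>k = m F V\<close>, the number of
    elements of \<open>U\<close> that \<open>F\<close> covers.\<close>
  also have "\<dots> \<le> ?E (\<lambda>V. (harm (card U) - m F V / n) * (\<Sum>G\<in>A - {F}. cost J G * x G V))"
  proof (intro integral_mono int mult_right_mono sum_nonneg mult_nonneg_nonneg)
    fix V
    show "harm (card (U - s F (V F))) \<le> harm (card U) - m F V / n"
      unfolding m_def n_def using fin(2)
      by (subst card_Diff_subset_Int) (auto intro!: harm_diff_le card_mono)
  qed (use c0 x0 in auto)
  also have "\<dots> = ?E (\<lambda>V. \<Sum>G\<in>A - {F}. cost J G * (harm (card U) * x G V - m F V / n * x G V))"
    by (simp only: sum_distrib_left left_diff_distrib right_diff_distrib mult_ac)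
  also have "\<dots> = (\<Sum>G\<in>A - {F}. cost J G * (harm (card U) * ?E (x G) - ?E (\<lambda>V. m F V / n * x G V)))"
    by (simp add: int del: times_divide_eq_left)
  also have "\<dots> = harm (card U) * (\<Sum>G\<in>A - {F}. cost J G * ?E (x G)) -
      (\<Sum>G\<in>A - {F}. cost J G * ?E (\<lambda>V. m F V / n * x G V))"
    by (simp add: right_diff_distrib sum_subtractf sum_distrib_left mult.left_commute)
  finally have le: "?E (\<lambda>V. \<Sum>G\<in>A. cost J G * ?P G V (Eval F k)) \<le>
      cost J F + (harm (card U) * (\<Sum>G\<in>A - {F}. cost J G * ?E (x G)) -
        (\<Sum>G\<in>A - {F}. cost J G * ?E (\<lambda>V. m F V / n * x G V)))"
    by simp

  \<comment> \<open>It remains to pay for \<open>F\<close>: its cost must be at most its own share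
    of the bound plus the loss subtracted in \<open>le\<close>.\<close>
  have "cost J F = \<rho> * ?E (m F)"
    using indep[OF F, of "\<lambda>_. 1"] cF by simp
  also have "\<dots> \<le> \<rho> * ?E (\<lambda>V. \<Sum>G\<in>A. m F V / n * x G V * m G V)"
  proof (intro mult_left_mono[OF _ \<rho>0] integral_mono_AE int)
    show "AE V in measure_pmf (Pi_pmf A d q). m F V \<le> (\<Sum>G\<in>A. m F V / n * x G V * m G V)"
      unfolding AE_measure_pmf_iff
    proof
      fix V
      assume V: "V \<in> set_pmf (Pi_pmf A d q)"
      \<comment> \<open>Summing the covering inequalities over \<open>U\<close> and counting by
        items gives \<open>n\<close> on the left; the result is scaled by
        \<open>m F V / n\<close>.\<close>
      have "n = (\<Sum>u\<in>U. 1)"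
        by (simp add: n_def)
      also have "\<dots> \<le> (\<Sum>u\<in>U. \<Sum>G | G \<in> A \<and> u \<in> s G (V G). x G V)"
        by (intro sum_mono xcov V)
      also have "\<dots> = (\<Sum>G\<in>A. \<Sum>u | u \<in> U \<and> u \<in> s G (V G). x G V)"
        by (rule sum.swap_restrict[OF fin(2,1)])
      also have "\<dots> = (\<Sum>G\<in>A. x G V * m G V)"
        by (intro sum.cong refl) (simp add: m_def Int_def)
      finally have "m F V / n * n \<le> m F V / n * (\<Sum>G\<in>A. x G V * m G V)"
        using m0 n by (intro mult_left_mono) auto
      thus "m F V \<le> (\<Sum>G\<in>A. m F V / n * x G V * m G V)"
        using n by (simp add: sum_distrib_left mult_ac)
    qed
  qed
  also have "\<dots> = \<rho> * ?E (\<lambda>V. m F V / n * x F V * m F V) +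
      (\<Sum>G\<in>A - {F}. \<rho> * ?E (\<lambda>V. m F V / n * x G V * m G V))"
    using F fin(1)
    by (simp add: Bochner_Integration.integral_sum int sum.remove distrib_left sum_distrib_left
        del: times_divide_eq_left)
  also have "\<dots> \<le> harm (card U) * (cost J F * ?E (x F)) +
      (\<Sum>G\<in>A - {F}. cost J G * ?E (\<lambda>V. m F V / n * x G V))"
  proof (intro add_mono sum_mono)
    \<comment> \<open>The factor \<open>m F V\<close> depends on \<open>V F\<close>, so
      \<open>indep\<close> does not apply with it included. Bound \<open>m F V / n\<close> by 1
      first; the whole coefficient of \<open>F\<close> is available and is at least 1 because
      \<open>U\<close> is nonempty.\<close>
    have "\<rho> * ?E (\<lambda>V. m F V / n * x F V * m F V) \<le> \<rho> * ?E (\<lambda>V. x F V * m F V)"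
    proof (intro mult_left_mono[OF _ \<rho>0] integral_mono int)
      fix V
      have "m F V / n * (x F V * m F V) \<le> 1 * (x F V * m F V)"
        using n mn m0 x0[OF F] by (intro mult_right_mono) auto
      thus "m F V / n * x F V * m F V \<le> x F V * m F V"
        by (simp only: mult_1 mult.assoc)
    qed
    also have "\<dots> = 1 * (cost J F * ?E (x F))"
      using indep[OF F, of "x F"] xupd[OF F] cF by simp
    also have "\<dots> \<le> harm (card U) * (cost J F * ?E (x F))"
    proof (rule mult_right_mono)
      have "harm 1 \<le> (harm (card U) :: real)"
        using n by (intro harm_mono) (simp add: n_def)
      thus "1 \<le> (harm (card U) :: real)"
        by (simp add: harm_def)
    qed (use c0 x0 F in \<open>auto intro: integral_nonneg\<close>)
    finally show "\<rho> * ?E (\<lambda>V. m F V / n * x F V * m F V) \<le> harm (card U) * (cost J F * ?E (x F))" .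
  next
    fix G
    assume G: "G \<in> A - {F}"
    \<comment> \<open>For \<open>G\<close> other than \<open>F\<close>,
      \<open>m F V / n * x G V\<close> ignores \<open>V G\<close>.\<close>
    have "?E (\<lambda>V. m F V / n * x G V * m G V) = ?E (\<lambda>V. m F V / n * x G V) * coverage J U G"
      using G by (intro indep) (auto simp: m_def xupd)
    hence "\<rho> * ?E (\<lambda>V. m F V / n * x G V * m G V) =
        (\<rho> * coverage J U G) * ?E (\<lambda>V. m F V / n * x G V)"
      by (simp only: mult_ac)
    also have "\<dots> \<le> cost J G * ?E (\<lambda>V. m F V / n * x G V)"
      using G c_ge n m0 x0 by (intro mult_right_mono integral_nonneg) auto
    finally show "\<rho> * ?E (\<lambda>V. m F V / n * x G V * m G V) \<le> cost J G * ?E (\<lambda>V. m F V / n * x G V)" .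
  qed
  finally show ?case
    using le F fin(1) by (simp add: sum.remove[of A F] distrib_left)
qed

section \<open>Cost through evaluation probabilities\<close>

text \<open>Linearity of expectation. A general kernel \<open>K\<close> allows use for
  \<open>edge_solution\<close>, whose tree reads derived states.\<close>

lemma expected_cost_eq_sum_prob:
  assumes I: "ssc_instance I"
    and sub: "\<And>V S. V \<in> set_pmf (states I) \<Longrightarrow> S \<in> set_pmf (K V) \<Longrightarrow> S \<subseteq> items I"
  shows "expected_cost I K = measure_pmf.expectation (states I)
    (\<lambda>V. \<Sum>F\<in>items I. cost I F * measure_pmf.prob (K V) {S. F \<in> S})"
proof -
  have fin: "finite (items I)"
    using I by (simp add: ssc_instance_def)
  have finK: "finite (set_pmf (K V))" if "V \<in> set_pmf (states I)" for V
    using sub[OF that] fin by (meson Pow_iff finite_Pow_iff finite_subset subsetI)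
  have "measure_pmf.expectation (K V) (\<lambda>S. \<Sum>F\<in>S. cost I F) =
      (\<Sum>F\<in>items I. cost I F * measure_pmf.prob (K V) {S. F \<in> S})"
    if V: "V \<in> set_pmf (states I)" for V
  proof -
    have "measure_pmf.expectation (K V) (\<lambda>S. \<Sum>F\<in>S. cost I F) =
        measure_pmf.expectation (K V) (\<lambda>S. \<Sum>F\<in>items I. cost I F * indicator {S. F \<in> S} S)"
    proof (intro integral_cong_AE AE_pmfI)
      fix S
      assume "S \<in> set_pmf (K V)"
      hence "items I \<inter> S = S"
        using sub[OF V] by blast
      thus "(\<Sum>F\<in>S. cost I F) = (\<Sum>F\<in>items I. cost I F * indicator {S. F \<in> S} S)"
        using fin by (simp add: indicator_def sum.If_cases mult_ac flip: if_distrib)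
    qed simp_all
    thus ?thesis
      using finK[OF V] by (simp add: integrable_measure_pmf_finite)
  qed
  thus ?thesis
    unfolding expected_cost_def outcome_def
    using finite_states[OF I] finK
    by (subst pmf_expectation_bind[of "set_pmf (states I)"])
      (auto simp: integral_measure_pmf[of "set_pmf (states I)"])
qed

section \<open>Covering the edges\<close>

lemma set_pmf_statesD:
  "ssc_instance I \<Longrightarrow> V \<in> set_pmf (states I) \<Longrightarrow> F \<in> items I \<Longrightarrow>
    V F \<in> set_pmf (state_pmf I F)"
  by (auto simp: states_def ssc_instance_def set_Pi_pmf PiE_dflt_def)

lemma fun_upd_in_states:
  assumes "ssc_instance I" "V \<in> set_pmf (states I)" "F \<in> items I" "B \<in> set_pmf (state_pmf I F)"
  shows "V(F := B) \<in> set_pmf (states I)"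
  using assms by (auto simp: states_def ssc_instance_def set_Pi_pmf PiE_dflt_def)

lemma marginal_pos_iff: "marginal I F e > 0 \<longleftrightarrow> (\<exists>B\<in>set_pmf (state_pmf I F). e \<in> B)"
  using measure_pmf_zero_iff[of "state_pmf I F" "{B. e \<in> B}"]
  by (auto simp: marginal_def zero_less_measure_iff)

lemma finite_edges: "ssc_instance I \<Longrightarrow> finite (edges I)"
  using ssc_instance_edge_instance[of I] by (simp add: ssc_instance_def edge_instance_def)

text \<open>A run that never evaluates \<open>F\<close> never reads \<open>V F\<close>, so the same
  internal choices give the same run after resampling.\<close>

lemma evaluated_fun_upd:
  "S \<in> set_pmf (evaluated V t) \<Longrightarrow> F \<notin> S \<Longrightarrow> S \<in> set_pmf (evaluated (V(F := B)) t)"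
proof (induction t arbitrary: S)
  case (Eval G k)
  then obtain S' where S': "S' \<in> set_pmf (evaluated V (k (V G)))" "S = insert G S'"
    by auto
  hence "S' \<in> set_pmf (evaluated (V(F := B)) (k (V G)))"
    using Eval.prems(2) by (intro Eval.IH) auto
  moreover have "G \<noteq> F"
    using S'(2) Eval.prems(2) by blast
  ultimately show ?case
    using S'(2) by (simp add: fun_upd_def)
next
  case (Randomize p)
  then obtain t where "t \<in> set_pmf p" "S \<in> set_pmf (evaluated V t)"
    by auto
  thus ?case
    using Randomize.IH[of t S] Randomize.prems(2) by (auto simp: fun_upd_def)
qed simp

text \<open>If \<open>F\<close> is not in \<open>S\<close>, give \<open>F\<close> a possible state
  containing \<open>e\<close>. The run \<open>S\<close> stays possible and its states are unchanged,
  yet feasibility now forces it to cover \<open>e\<close>.\<close>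

lemma feasible_covers_edges:
  assumes "ssc_instance I" "feasible I (\<lambda>V. evaluated V t)"
    and "V \<in> set_pmf (states I)" "S \<in> set_pmf (evaluated V t)" "(F, e) \<in> edges I"
  shows "F \<in> S \<or> e \<in> (\<Union>G\<in>S. V G)"
proof (cases "F \<in> S")
  case False
  have F: "F \<in> items I"
    using assms(5) by (simp add: edges_def)
  obtain B where B: "B \<in> set_pmf (state_pmf I F)" "e \<in> B"
    using assms(5) by (auto simp: edges_def marginal_pos_iff)
  have "(\<Union>G\<in>S. (V(F := B)) G) = (\<Union>G\<in>items I. (V(F := B)) G)"
    using assms(2) fun_upd_in_states[OF assms(1,3) F B(1)] evaluated_fun_upd[OF assms(4) False]
    unfolding feasible_iff by blast
  moreover have "(\<Union>G\<in>S. (V(F := B)) G) = (\<Union>G\<in>S. V G)"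
    using False by auto
  moreover have "e \<in> (\<Union>G\<in>items I. (V(F := B)) G)"
    using F B(2) by force
  ultimately show ?thesis
    by blast
qed simp

text \<open>The invariant is that the own item of every uncovered edge is still available. It covers
  that edge surely, so greedy is never stuck; evaluating \<open>F\<close> removes all edges of
  \<open>F\<close>, which preserves the invariant.\<close>

lemma greedy_covers_edges:
  assumes "greedy (edge_instance I) A U t" "ssc_instance I" "U \<subseteq> edges I" "fst ` U \<subseteq> A"
    and "\<And>F. F \<in> A \<Longrightarrow> W F \<in> set_pmf (state_pmf (edge_instance I) F)"
    and "S \<in> set_pmf (evaluated W t)"
  shows "U \<subseteq> (\<Union>F\<in>S. W F)"
  using assms
proof (induction arbitrary: S rule: greedy.induct)
  case (stuck U A)
  then obtain F e where Fe: "(F, e) \<in> U"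
    by fastforce
  have "marginal (edge_instance I) F (F, e) > 0"
    using Fe stuck.prems(2) by (auto simp: marginal_edge_instance)
  hence "coverage (edge_instance I) U F > 0"
    unfolding coverage_def using Fe finite_subset[OF stuck.prems(2) finite_edges[OF stuck.prems(1)]]
    by (intro sum_pos2[of _ "(F, e)"]) (auto simp: marginal_def)
  thus ?case
    using stuck Fe by force
next
  case (step U A F k)
  from step.prems(5) obtain S' where S': "S' \<in> set_pmf (evaluated W (k (W F)))" "S = insert F S'"
    by auto
  have F: "F \<in> A"
    using step.hyps(2) by (simp add: is_arg_min_def)
  obtain B where "W F = edge_state I F B"
    using step.prems(4)[OF F] by (auto simp: edge_instance_def)
  hence "fst ` (U - W F) \<subseteq> A - {F}"
    using step.prems(2,3) by (auto simp: edge_state_def)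
  hence "U - W F \<subseteq> (\<Union>F\<in>S'. W F)"
    using step.IH[rule_format, OF step.prems(4)[OF F]] step.prems S'(1) by blast
  thus ?case
    using S'(2) by blast
qed auto

section \<open>Feasibility and the harmonic bound\<close>

theorem theorem2:
  fixes I :: "('a, 'b) ssc" and g :: "('a, 'a \<times> 'b) alg"
  assumes "ssc_instance I"
    and "greedy_algorithm (edge_instance I) g"
  shows "feasible I (edge_solution I g) \<and>
    (\<forall>opt. optimal_algorithm I opt \<longrightarrow>
       expected_cost I (edge_solution I g) \<le>
         harm (card (edges I)) * expected_cost I (\<lambda>V. evaluated V opt))"
proof (intro conjI allI impI)
  have greedy: "greedy (edge_instance I) (items I) (edges I) g"
    using assms(2) by (simp add: greedy_algorithm_def edge_instance_def)
  have fin: "finite (items I)"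
    using assms(1) by (simp add: ssc_instance_def)
  have W: "edge_state I F (V F) \<in> set_pmf (state_pmf (edge_instance I) F)"
    if "V \<in> set_pmf (states I)" "F \<in> items I" for V F
    using set_pmf_statesD[OF assms(1) that] by (simp add: edge_instance_def)
  have sub: "S \<subseteq> items I" if "V \<in> set_pmf (states I)" "S \<in> set_pmf (edge_solution I g V)" for V S
    using greedy_evaluated_subset[OF greedy, of "\<lambda>F. edge_state I F (V F)"] W that
    unfolding edge_solution_def by blast
  show "feasible I (edge_solution I g)"
    unfolding feasible_iff
  proof (intro ballI equalityI)
    fix V S
    assume V: "V \<in> set_pmf (states I)" and S: "S \<in> set_pmf (edge_solution I g V)"
    show "(\<Union>F\<in>S. V F) \<subseteq> (\<Union>F\<in>items I. V F)"
      using sub[OF V S] by blast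
    have covered: "edges I \<subseteq> (\<Union>F\<in>S. edge_state I F (V F))"
      using greedy_covers_edges[OF greedy assms(1), of "\<lambda>F. edge_state I F (V F)" S] W[OF V] S
      unfolding edge_solution_def by (force simp: edges_def)
    show "(\<Union>F\<in>items I. V F) \<subseteq> (\<Union>F\<in>S. V F)"
    proof
      fix e
      assume "e \<in> (\<Union>F\<in>items I. V F)"
      then obtain F where F: "F \<in> items I" "e \<in> V F"
        by blast
      have "V F \<in> set_pmf (state_pmf I F)"
        using assms(1) V F(1) by (rule set_pmf_statesD)
      hence "(F, e) \<in> edges I"
        using F assms(1) by (auto simp: edges_def marginal_pos_iff ssc_instance_def)
      \<comment> \<open>The edge \<open>(F, e)\<close> is covered by \<open>F\<close> itself or by
        an item whose state contains \<open>e\<close>; in both cases \<open>e\<close> is covered in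
        \<open>I\<close>.\<close>
      with covered obtain G where "G \<in> S" "F = G \<or> e \<in> V G"
        by (force simp: edge_state_def)
      thus "e \<in> (\<Union>F\<in>S. V F)"
        using F(2) by blast
    qed
  qed
  fix opt
  assume "optimal_algorithm I opt"
  hence opt: "alg_items opt \<subseteq> items I" "feasible I (\<lambda>V. evaluated V opt)"
    by (auto simp: optimal_algorithm_def feasible_algorithm_def)
  define x where "x = (\<lambda>F V. measure_pmf.prob (evaluated V opt) {S. F \<in> S})"
  have cover: "1 \<le> (\<Sum>F | F \<in> items I \<and> u \<in> edge_state I F (V F). x F V)"
    if V: "V \<in> set_pmf (states I)" and u: "u \<in> edges I" for V u
  proof -
    obtain F e where Fe: "u = (F, e)"
      by (cases u)
    let ?T = "{F \<in> items I. u \<in> edge_state I F (V F)}"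
    have "\<exists>G\<in>?T. G \<in> S" if S: "S \<in> set_pmf (evaluated V opt)" for S
      using feasible_covers_edges[OF assms(1) opt(2) V S, of F e] u Fe
        evaluated_subset[OF S] opt(1)
      by (auto simp: edge_state_def)
    \<comment> \<open>Surely some item covering \<open>u\<close> is evaluated, so the union bound
      makes \<open>x\<close> a fractional cover.\<close>
    hence "1 = measure_pmf.prob (evaluated V opt) (\<Union>G\<in>?T. {S. G \<in> S})"
      by (subst eq_commute, subst measure_pmf.prob_eq_1) (auto simp: AE_measure_pmf_iff)
    also have "\<dots> \<le> (\<Sum>G\<in>?T. x G V)"
      unfolding x_def using fin by (intro measure_pmf.finite_measure_subadditive_finite) auto
    finally show ?thesis .
  qed
  have fin_states: "integrable (measure_pmf (states I)) h" for h :: "_ \<Rightarrow> real"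
    by (intro integrable_measure_pmf_finite finite_states assms)
  have "expected_cost I (edge_solution I g) = measure_pmf.expectation (states I)
      (\<lambda>V. \<Sum>F\<in>items I. cost (edge_instance I) F *
        measure_pmf.prob (evaluated (\<lambda>F. edge_state I F (V F)) g) {S. F \<in> S})"
    by (subst expected_cost_eq_sum_prob[OF assms(1) sub]) (auto simp: edge_solution_def edge_instance_def)
  also have "\<dots> \<le> harm (card (edges I)) *
      (\<Sum>F\<in>items I. cost (edge_instance I) F * measure_pmf.expectation (states I) (x F))"
    unfolding states_def
  \<comment> \<open>Here \<open>q\<close> is the state law of \<open>I\<close> and \<open>s\<close>
    is \<open>edge_state I\<close>, since \<open>x\<close> depends on the original states.\<close>
  proof (rule greedy_cost_le[OF greedy fin finite_edges[OF assms(1)]])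
    fix F
    assume "F \<in> items I"
    thus "finite (set_pmf (state_pmf I F))"
      using assms(1) by (auto simp: ssc_instance_def intro: finite_subset)
  qed (use assms(1) cover in \<open>auto simp: edge_instance_def ssc_instance_def x_def
      prob_evaluated_upd states_def\<close>)
  also have "(\<Sum>F\<in>items I. cost (edge_instance I) F * measure_pmf.expectation (states I) (x F)) =
      expected_cost I (\<lambda>V. evaluated V opt)"
    using evaluated_subset opt(1)
    by (subst expected_cost_eq_sum_prob[OF assms(1)])
      (force simp: x_def edge_instance_def fin_states)+
  finally show "expected_cost I (edge_solution I g) \<le>
      harm (card (edges I)) * expected_cost I (\<lambda>V. evaluated V opt)" .
qed

end
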